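(* Let $k>0$. For $\lambda,\rho,v\in\mathbb{C}$ with $\Re\left(\frac{v}{k}\right)>-1$, $\Re(\lambda+\rho)>0$, $\Re\left(\lambda+\frac{v}{k}\right)>0$ and $z>0$ (where $z$ is the variable of integration), the following holds, $y$ being a parameter: $$\int_{0}^{1}z^{\lambda-1}(1-z)^{2(\lambda+\rho)-1}\left(1-\frac{z}{3}\right)^{2\lambda-1}\left(1-\frac{z}{4}\right)^{(\lambda+\rho)-1}I_{v}^{k}\left(\frac{yz\left(1-\frac{z}{3}\right)^2}{2}\right)dz$$ $$=\frac{\left(\frac{y}{2}\right)^{v/k}\,\Gamma(\lambda+\rho)\left(\frac{2}{3}\right)^{2(\lambda+\frac{v}{k})}}{k^{v/k}}\;{}_1\Psi_{2}\left[\begin{array}{c}\left(\lambda+\frac{v}{k},2\right)\\ \left(\frac{v}{k}+1,1\right),\ \left(2\lambda+\frac{v}{k}+\rho,2\right)\end{array};\ -\frac{4y^2}{81k}\right].$$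
   Context: The $k$-gamma function is $\Gamma_k(s)=\int_0^\infty t^{s-1}e^{-t^k/k}\,dt$, and satisfies $\Gamma_k(s)=k^{\frac{s}{k}-1}\Gamma(s/k)$, where $\Gamma$ is the gamma function. The modified $k$-Bessel function is given, for $k>0$, by $$I_{v}^{k}(x)=\sum_{n=0}^{\infty}\frac{1}{\Gamma_k(v+nk+k)\,n!}\left(\frac{x}{2}\right)^{\frac{v}{k}+2n}.$$ The Wright-type hypergeometric function is $${}_1\Psi_2\left[\begin{array}{c}(\alpha_1,A_1)\\(\beta_1,B_1),(\beta_2,B_2)\end{array};x\right]=\sum_{n=0}^\infty\frac{\Gamma(\alpha_1+A_1n)}{\Gamma(\beta_1+B_1n)\Gamma(\beta_2+B_2n)}\frac{x^n}{n!}.$$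
   Formalization: The printed right-hand side is false (e.g. k=1, v=0, λ=1, ρ=0, y=9/2); the factor (y/2)^{v/k} is corrected to (y/4)^{v/k} and the argument −4y²/(81k) of the Wright function to y²/(81k). *)

theory Defs
  imports "HOL-Analysis.Analysis"
begin

(* The principal branch of the power.  It differs from powr only in 0^0 = 1 (the library has
   0 powr 0 = 0), so that the series of I_0^k has the value 1 at the origin.
   As for powr, 0^w = 0 for w other than 0. *)
definition cpow :: "complex \<Rightarrow> complex \<Rightarrow> complex" where
  "cpow x w = (if x = 0 \<and> w = 0 then 1 else x powr w)"

(* The integral converges for Re s > 0 and k > 0. *)
definition k_Gamma :: "real \<Rightarrow> complex \<Rightarrow> complex" where
  "k_Gamma k s =
     integral {0..} (\<lambda>t. complex_of_real t powr (s - 1) * complex_of_real (exp (- (t powr k) / k)))"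

definition k_Bessel_I :: "real \<Rightarrow> complex \<Rightarrow> complex \<Rightarrow> complex" where
  "k_Bessel_I k v x =
     (\<Sum>n. 1 / (k_Gamma k (v + of_nat n * of_real k + of_real k) * fact n)
           * cpow (x / 2) (v / of_real k + 2 * of_nat n))"

(* Gamma takes the value 0 at its poles, so terms in which a denominator factor has a pole
   vanish, as they should. *)
definition Wright_1Psi2 ::
  "complex \<Rightarrow> real \<Rightarrow> complex \<Rightarrow> real \<Rightarrow> complex \<Rightarrow> real \<Rightarrow> complex \<Rightarrow> complex" where
  "Wright_1Psi2 \<alpha> A \<beta>1 B1 \<beta>2 B2 x =
     (\<Sum>n. Gamma (\<alpha> + of_real A * of_nat n)
           / (Gamma (\<beta>1 + of_real B1 * of_nat n) * Gamma (\<beta>2 + of_real B2 * of_nat n))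
           * (x ^ n / fact n))"

end

(* The substitution t = (9/4) z (1 - z/3)^2 maps (0,1) onto itself and satisfies
   1 - t = (1 - z)^2 (1 - z/4); it turns the kernel of the theorem into that of Euler's Beta
   integral (the Lavoie-Trottier integral).  Multiplying the kernel by (z (1 - z/3)^2)^c only shifts
   its first parameter by c, so every term of the Bessel series integrates to a Beta value.  Since
   0 < z (1 - z/3)^2 <= 1 on (0,1), the series may be integrated termwise by dominated convergence. *)
theory Submission
  imports Defs
begin

text \<open>Integrability at 0 comes from the Bessel function, not from the weight:
  \<open>Re lam\<close> may be negative, and only \<open>Re (lam + v / k) > 0\<close> is given. So
  with \<open>w = v / k\<close> and \<open>r = z * (1 - z / 3)^2\<close> the factor
  \<open>r powr w\<close> is pulled out of the whole series and absorbed into the kernel before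
  anything is integrated; what remains is a power series in \<open>r^2\<close> against an absolutely
  integrable kernel with first parameter \<open>lam + w\<close>. The kernel is handled on the open
  interval, where all bases are positive reals and complex powers multiply without regard to the
  branch cut. Only y is an arbitrary complex number, and its power leaves the integral as a
  constant. Constants: half the Bessel argument is \<open>y * r / 4\<close>, whence the base
  \<open>y / 4\<close> of the prefactor. The n-th term carries the n-th powers of
  \<open>(y / 4)^2 / k\<close> and of \<open>(2 / 3)^4 = 16 / 81\<close>, with product
  \<open>y^2 / (81 * k)\<close>; the series of I does not alternate, so the sign is plus. The formal
  statement has these values where the English formula has \<open>y / 2\<close> and
  \<open>-4 y^2 / (81 k)\<close>.\<close>

section \<open>Change of variables, and Euler's Beta integral for complex parameters\<close>

lemma absolutely_has_integral_change_of_variables: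
  fixes f :: "real \<Rightarrow> 'a::euclidean_space" and g h :: "real \<Rightarrow> real"
  assumes "S \<in> sets lebesgue"
    and "\<And>x. x \<in> S \<Longrightarrow> (g has_field_derivative h x) (at x within S)"
    and "inj_on g S"
    and "f absolutely_integrable_on (g ` S)" and "(f has_integral b) (g ` S)"
  shows "(\<lambda>x. \<bar>h x\<bar> *\<^sub>R f (g x)) absolutely_integrable_on S"
    and "((\<lambda>x. \<bar>h x\<bar> *\<^sub>R f (g x)) has_integral b) S"
proof -
  have "integral (g ` S) f = b"
    using assms(5) by (rule integral_unique)
  then have *: "(\<lambda>x. \<bar>h x\<bar> *\<^sub>R f (g x)) absolutely_integrable_on S \<and>
      integral S (\<lambda>x. \<bar>h x\<bar> *\<^sub>R f (g x)) = b"
    using has_absolute_integral_change_of_variables_real[OF assms(1-3), of f b] assms(4) by simp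
  then show "(\<lambda>x. \<bar>h x\<bar> *\<^sub>R f (g x)) absolutely_integrable_on S" by blast
  with * show "((\<lambda>x. \<bar>h x\<bar> *\<^sub>R f (g x)) has_integral b) S"
    using set_lebesgue_integral_eq_integral(1) by (simp add: has_integral_iff)
qed

text \<open>For positive t the modulus of \<open>t powr s\<close> is \<open>t powr Re s\<close>, so
  the real Beta integrand with parameters \<open>Re a\<close> and \<open>Re b\<close> is the
  modulus. Absolute integrability is what the later changes of variables ask for.\<close>

lemma absolutely_integrable_Beta_complex:
  assumes "Re a > 0" "Re b > 0"
  shows "(\<lambda>t. of_real t powr (a - 1) * of_real (1 - t) powr (b - 1) :: complex)
           absolutely_integrable_on {0<..<1}"
proof (rule measurable_bounded_by_integrable_imp_absolutely_integrable)
  show "(\<lambda>t. t powr (Re a - 1) * (1 - t) powr (Re b - 1)) integrable_on {0<..<1::real}"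
    using integrable_Beta'[OF assms] by (simp add: integrable_on_Icc_iff_Ioo)
  have "continuous_on {0<..<1} (\<lambda>t. of_real t powr (a - 1) * of_real (1 - t) powr (b - 1) :: complex)"
    by (intro continuous_intros) (auto simp del: of_real_diff)
  then show "(\<lambda>t. of_real t powr (a - 1) * of_real (1 - t) powr (b - 1) :: complex)
      \<in> borel_measurable (lebesgue_on {0<..<1})"
    by (rule continuous_imp_measurable_on_sets_lebesgue) simp
qed (auto simp: norm_mult norm_powr_real_powr simp del: of_real_diff)

text \<open>Two relations are combined to eliminate \<open>J (a + 1) b\<close>: splitting 1 as t +
  (1 - t) gives \<open>J a b = J (a + 1) b + J a (b + 1)\<close>, and integrating the derivative of
  t^a (1 - t)^b, which vanishes at both ends, gives
  \<open>a * J a (b + 1) = b * J (a + 1) b\<close>.\<close>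

lemma Beta_complex_integral_shift:
  assumes a: "Re a > 0" and b: "Re b > 0"
  defines "J \<equiv> \<lambda>a b. integral {0<..<1} (\<lambda>t. of_real t powr (a - 1) * of_real (1 - t) powr (b - 1) :: complex)"
  shows "b * J a b = (a + b) * J a (b + 1)"
proof -
  have J: "((\<lambda>t. of_real t powr (a - 1) * of_real (1 - t) powr (b - 1) :: complex) has_integral J a b) {0<..<1}"
    if "Re a > 0" "Re b > 0" for a b
    unfolding J_def using absolutely_integrable_Beta_complex[OF that]
    by (intro integrable_integral) (simp add: set_lebesgue_integral_eq_integral(1))
  have J1: "((\<lambda>t. of_real t powr a * of_real (1 - t) powr (b - 1) :: complex) has_integral J (a + 1) b) {0<..<1}"
    using J[of "a + 1" b] a b by simp
  have J2: "((\<lambda>t. of_real t powr (a - 1) * of_real (1 - t) powr b :: complex) has_integral J a (b + 1)) {0<..<1}"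
    using J[of a "b + 1"] a b by simp
  have "((\<lambda>t. of_real t powr a * of_real (1 - t) powr (b - 1) +
      of_real t powr (a - 1) * of_real (1 - t) powr b :: complex) has_integral J (a + 1) b + J a (b + 1)) {0<..<1}"
    by (intro has_integral_add J1 J2)
  then have "((\<lambda>t. of_real t powr (a - 1) * of_real (1 - t) powr (b - 1) :: complex)
      has_integral J (a + 1) b + J a (b + 1)) {0<..<1}"
  proof (rule has_integral_eq[rotated])
    fix t :: real assume t: "t \<in> {0<..<1}"
    have eqs: "complex_of_real t powr a = of_real t powr (a - 1) * of_real t"
      "complex_of_real (1 - t) powr b = of_real (1 - t) powr (b - 1) * of_real (1 - t)"
      using t powr_add[of "complex_of_real t" "a - 1" 1] powr_add[of "complex_of_real (1 - t)" "b - 1" 1]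
      by (simp_all del: of_real_diff)
    show "of_real t powr a * of_real (1 - t) powr (b - 1) +
      of_real t powr (a - 1) * of_real (1 - t) powr b =
      of_real t powr (a - 1) * (of_real (1 - t) powr (b - 1) :: complex)"
      unfolding eqs by (simp add: algebra_simps)
  qed
  then have sum: "J a b = J (a + 1) b + J a (b + 1)"
    using J[OF a b] has_integral_unique by blast
  let ?F = "\<lambda>t. complex_of_real t powr a * of_real (1 - t) powr b"
  have ftc: "((\<lambda>t. a * (of_real t powr (a - 1) * of_real (1 - t) powr b)
      - b * (of_real t powr a * of_real (1 - t) powr (b - 1))) has_integral ?F 1 - ?F 0) {0..1}"
  \<comment> \<open>The derivative may be unbounded at the ends, so it is taken only inside;
    \<open>?F\<close> is continuous up to the ends because \<open>Re a\<close> and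
    \<open>Re b\<close> are positive.\<close>
  proof (rule fundamental_theorem_of_calculus_interior)
    show "continuous_on {0..1} ?F"
      using a b by (auto intro!: continuous_intros simp del: of_real_diff)
    fix t :: real assume t: "t \<in> {0<..<1}"
    have "1 - complex_of_real t \<notin> \<real>\<^sub>\<le>\<^sub>0"
      using t by (simp add: complex_nonpos_Reals_iff)
    then have "((\<lambda>z. z powr a * (1 - z) powr b) has_field_derivative
        (a * of_real t powr (a - 1) * (1 - of_real t) powr b
        - b * of_real t powr a * (1 - of_real t) powr (b - 1))) (at (of_real t))"
      using t by (auto intro!: derivative_eq_intros simp del: of_real_diff)
    from has_vector_derivative_real_field[OF this]
    show "(?F has_vector_derivative a * (of_real t powr (a - 1) * of_real (1 - t) powr b)
      - b * (of_real t powr a * of_real (1 - t) powr (b - 1))) (at t)"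
      by (simp add: mult.assoc)
  qed simp
  have F: "?F 1 - ?F 0 = 0"
    using a b by auto
  have zero: "((\<lambda>t. a * (of_real t powr (a - 1) * of_real (1 - t) powr b)
      - b * (of_real t powr a * of_real (1 - t) powr (b - 1))) has_integral 0) {0<..<1}"
    using ftc unfolding has_integral_Icc_iff_Ioo F .
  have "((\<lambda>t. a * (of_real t powr (a - 1) * of_real (1 - t) powr b)
      - b * (of_real t powr a * of_real (1 - t) powr (b - 1))) has_integral a * J a (b + 1) - b * J (a + 1) b) {0<..<1}"
    by (intro has_integral_diff has_integral_mult_right J1 J2)
  from has_integral_unique[OF zero this] sum show ?thesis by (simp add: algebra_simps)
qed

lemma Beta_complex_integral_pochhammer:
  assumes a: "Re a > 0" and b: "Re b > 0"
  defines "J \<equiv> \<lambda>a b. integral {0<..<1} (\<lambda>t. of_real t powr (a - 1) * of_real (1 - t) powr (b - 1) :: complex)"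
  shows "pochhammer b n * J a b = pochhammer (a + b) n * J a (b + of_nat n)"
proof (induction n)
  case (Suc n)
  have "(b + of_nat n) * J a (b + of_nat n) = (a + (b + of_nat n)) * J a (b + of_nat n + 1)"
    unfolding J_def by (rule Beta_complex_integral_shift) (use a b in auto)
  then have "pochhammer b n * J a b * (b + of_nat n)
      = pochhammer (a + b) n * ((a + (b + of_nat n)) * J a (b + of_nat n + 1))"
    using Suc by (simp add: mult.assoc mult.commute)
  then show ?case
    by (simp add: pochhammer_Suc ac_simps)
qed simp

text \<open>
  The library has the Beta integral for real parameters only. For complex ones, write
  \<open>J a b\<close> for the integral: \<open>J a b\<close> is a quotient of Pochhammer symbols times \<open>J a (b + n)\<close>, and the
  rescaled integral below tends to Euler's integral for \<open>Gamma a\<close>, because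
  \<open>(1 - u / n)\<close> to the power \<open>n\<close> tends to \<open>exp (- u)\<close>.
\<close>

lemma Beta_complex_integral_limit:
  assumes a: "Re a > 0" and b: "Re b > 0"
  shows "(\<lambda>n. of_nat n powr a * integral {0<..<1}
            (\<lambda>t. of_real t powr (a - 1) * of_real (1 - t) powr (b + of_nat n) :: complex)) \<longlonglongrightarrow> Gamma a"
proof -
  \<comment> \<open>The exponent \<open>b + n\<close> belongs to the second Beta parameter
    \<open>b + Suc n\<close>: in \<open>Gamma_series b n\<close> the Pochhammer symbol has length
    \<open>Suc n\<close>.\<close>
  define J where "J n = integral {0<..<1}
            (\<lambda>t. of_real t powr (a - 1) * of_real (1 - t) powr (b + of_nat n) :: complex)" for n
  \<comment> \<open>The integrand after t = u / n, extended by zero so that all n share one domain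
    of integration.\<close>
  let ?f = "\<lambda>n u. if u \<in> {0<..<real n} then of_real u powr (a - 1) * of_real (1 - u / n) powr (b + of_nat n) else 0 :: complex"
  have int: "(?f n has_integral of_nat n powr a * J n) {0<..}" for n :: nat
  proof (cases "n = 0")
    case False
    have img: "(\<lambda>u. u / real n) ` {0<..<real n} = {0<..<1}"
      using False by (auto simp: image_iff field_simps intro!: bexI[of _ "_ * real n"])
    have abs: "(\<lambda>t. of_real t powr (a - 1) * of_real (1 - t) powr (b + of_nat n) :: complex) absolutely_integrable_on {0<..<1}"
      using absolutely_integrable_Beta_complex[of a "b + of_nat n + 1"] a b by simp
    then have "((\<lambda>t. of_real t powr (a - 1) * of_real (1 - t) powr (b + of_nat n) :: complex) has_integral J n) {0<..<1}"
      unfolding J_def by (intro integrable_integral) (simp add: set_lebesgue_integral_eq_integral(1))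
    then have "((\<lambda>u. \<bar>1 / n\<bar> *\<^sub>R (of_real (u / n) powr (a - 1) * of_real (1 - u / n) powr (b + of_nat n) :: complex))
       has_integral J n) {0<..<real n}"
      using False abs unfolding img[symmetric]
      by (intro absolutely_has_integral_change_of_variables(2))
         (auto intro!: derivative_eq_intros inj_onI)
    then have "((\<lambda>u. of_nat n powr a * (\<bar>1 / n\<bar> *\<^sub>R (of_real (u / n) powr (a - 1) * of_real (1 - u / n) powr (b + of_nat n))))
       has_integral of_nat n powr a * J n) {0<..<real n}"
      by (rule has_integral_mult_right)
    then have "((\<lambda>u. of_real u powr (a - 1) * of_real (1 - u / n) powr (b + of_nat n) :: complex)
       has_integral of_nat n powr a * J n) {0<..<real n}"
    proof (rule has_integral_eq[rotated])
      fix u assume u: "u \<in> {0<..<real n}"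
      have "of_real u powr (a - 1) = of_nat n powr (a - 1) * complex_of_real (u / n) powr (a - 1)"
        using u False by (subst powr_times_real_left[symmetric]) (auto)
      moreover have "of_nat n powr a = of_nat n powr (a - 1) * (of_nat n :: complex)"
        using False powr_add[of "of_nat n :: complex" "a - 1" 1] by simp
      ultimately show "of_nat n powr a * (\<bar>1 / n\<bar> *\<^sub>R (of_real (u / n) powr (a - 1) * of_real (1 - u / n) powr (b + of_nat n)))
        = of_real u powr (a - 1) * (of_real (1 - u / n) powr (b + of_nat n) :: complex)"
        using False by (simp add: scaleR_conv_of_real)
    qed
    then show ?thesis
      by (subst has_integral_restrict) auto
  \<comment> \<open>For n = 0 the interval is empty and \<open>0 powr a\<close> is 0, so both sides
    vanish.\<close>
  qed auto
  have "(\<lambda>n. integral {0<..} (?f n)) \<longlonglongrightarrow>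
      integral {0<..} (\<lambda>t. complex_of_real t powr (a - 1) / of_real (exp t))"
  proof (rule dominated_convergence(2))
    show "?f n integrable_on {0<..}" for n
      using int[of n] by (rule has_integral_integrable)
    show "(\<lambda>u. norm (complex_of_real u powr (a - 1) / of_real (exp u))) integrable_on {0<..}"
      using absolutely_integrable_Gamma_integral'[OF a] by (simp add: absolutely_integrable_on_def)
    show "norm (?f n u) \<le> norm (complex_of_real u powr (a - 1) / of_real (exp u))"
      if "u \<in> {0<..}" for n u
    proof (cases "u < real n")
      case True
      have u: "0 < u" "0 < 1 - u / n" "1 - u / n \<le> 1"
        using that True by (auto simp: field_simps)
      \<comment> \<open>A bound free of n: the base is at most 1 and \<open>Re b\<close> is
        positive, so dropping \<open>Re b\<close> from the exponent can only enlarge the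
        power.\<close>
      have "(1 - u / n) powr (Re b + n) \<le> (1 - u / n) powr n"
        using u b by (intro powr_mono') auto
      also have "\<dots> = (1 - u / n) ^ n"
        using u by (simp add: powr_realpow)
      also have "\<dots> \<le> exp (- u)"
        using u True by (intro exp_ge_one_minus_x_over_n_power_n) auto
      finally have "u powr (Re a - 1) * (1 - u / n) powr (Re b + n) \<le> u powr (Re a - 1) * exp (- u)"
        by (intro mult_left_mono) auto
      then show ?thesis
        using u True
        by (simp add: norm_mult norm_divide norm_powr_real_powr exp_minus divide_inverse norm_inverse del: of_real_diff)
    qed auto
    show "(\<lambda>n. ?f n u) \<longlonglongrightarrow> complex_of_real u powr (a - 1) / of_real (exp u)"
      if "u \<in> {0<..}" for u
    \<comment> \<open>Once n exceeds u, the cutoff is inactive and the base is nonzero, so the power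
      splits into one with fixed exponent b, tending to 1, and an n-th power, tending to exp
      (-u).\<close>
    proof (rule Lim_transform_eventually)
      have *: "(\<lambda>n. 1 - u / real n) \<longlonglongrightarrow> 1 - 0"
        by (intro tendsto_intros lim_const_over_n)
      have "(\<lambda>n. complex_of_real (1 - u / real n)) \<longlonglongrightarrow> of_real (1 - 0)"
        by (rule tendsto_of_real[OF *])
      then have "(\<lambda>n. complex_of_real (1 - u / real n) powr b) \<longlonglongrightarrow> 1 powr b"
        by (intro tendsto_powr_complex tendsto_const) auto
      note limit = tendsto_mult[OF tendsto_const tendsto_mult[OF this]]
      have "(\<lambda>n. of_real u powr (a - 1) * (complex_of_real (1 - u / real n) powr b
          * complex_of_real ((1 + (- u) / real n) ^ n))) \<longlonglongrightarrow>
          of_real u powr (a - 1) * (1 powr b * complex_of_real (exp (- u)))"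
        by (rule limit) (intro tendsto_of_real tendsto_exp_limit_sequentially)
      then show "(\<lambda>n. of_real u powr (a - 1) * (complex_of_real (1 - u / real n) powr b
          * complex_of_real ((1 + (- u) / real n) ^ n))) \<longlonglongrightarrow> complex_of_real u powr (a - 1) / of_real (exp u)"
        by (simp add: exp_minus divide_inverse)
      show "\<forall>\<^sub>F n in sequentially. of_real u powr (a - 1) * (complex_of_real (1 - u / real n) powr b
          * complex_of_real ((1 + (- u) / real n) ^ n)) = ?f n u"
        using eventually_gt_at_top[of "nat \<lceil>u\<rceil>"]
      proof eventually_elim
        case (elim n)
        then have n: "u < real n" by linarith
        with that have "1 - u / n \<noteq> 0" by (auto simp: field_simps)
        then have "complex_of_real (1 - u / n) powr (b + of_nat n)
            = of_real (1 - u / n) powr b * of_real (1 - u / n) ^ n"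
          by (simp add: powr_add powr_nat' del: of_real_diff)
        with n that show ?case
          by (simp del: of_real_diff)
      qed
    qed
  qed
  moreover have "integral {0<..} (?f n) = of_nat n powr a * J n" for n
    using int by (rule integral_unique)
  moreover have "integral {0<..} (\<lambda>t. complex_of_real t powr (a - 1) / of_real (exp t)) = Gamma a"
    using Gamma_integral_complex'[OF a] by (rule integral_unique)
  ultimately show ?thesis
    by (simp add: J_def)
qed

theorem has_integral_Beta_complex:
  assumes a: "Re a > 0" and b: "Re b > 0"
  shows "((\<lambda>t. of_real t powr (a - 1) * of_real (1 - t) powr (b - 1) :: complex)
           has_integral Beta a b) {0<..<1}"
proof -
  define J where "J a b = integral {0<..<1}
    (\<lambda>t. of_real t powr (a - 1) * of_real (1 - t) powr (b - 1) :: complex)" for a b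
  have nz: "z \<notin> \<int>\<^sub>\<le>\<^sub>0" if "Re z > 0" for z :: complex
    using that by (auto elim!: nonpos_Ints_cases)
  have pnz: "pochhammer z n \<noteq> 0" if "Re z > 0" for z :: complex and n
    using nz[OF that] by (auto simp: pochhammer_eq_0_iff)
  have "(\<lambda>n. of_nat n powr a * J a (b + of_nat (Suc n))) \<longlonglongrightarrow> Gamma a"
    using Beta_complex_integral_limit[OF a b] by (simp add: J_def)
  \<comment> \<open>The quotient of the two Gamma series is n^(-a) times a quotient of Pochhammer
    symbols of length \<open>Suc n\<close>. This cancels the other factors exactly, so the sequence
    is constantly \<open>J a b\<close> for n > 0 and its limit is the value sought.\<close>
  then have "(\<lambda>n. of_nat n powr a * J a (b + of_nat (Suc n)) * (Gamma_series b n / Gamma_series (a + b) n))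
      \<longlonglongrightarrow> Gamma a * (Gamma b / Gamma (a + b))"
    using nz[of "a + b"] a b by (intro tendsto_intros) (auto simp: Gamma_eq_zero_iff)
  moreover have "\<forall>\<^sub>F n in sequentially. of_nat n powr a * J a (b + of_nat (Suc n)) *
      (Gamma_series b n / Gamma_series (a + b) n) = J a b"
    using eventually_gt_at_top[of 0]
  proof eventually_elim
    case (elim n)
    have "Gamma_series b n / Gamma_series (a + b) n =
        exp (b * of_real (ln (real n))) / exp ((a + b) * of_real (ln (real n)))
        * (pochhammer (a + b) (Suc n) / pochhammer b (Suc n))"
      by (simp add: Gamma_series_def)
    also have "exp (b * of_real (ln (real n))) / exp ((a + b) * of_real (ln (real n))) =
        1 / exp (a * of_real (ln (real n)))"
      by (simp add: exp_add distrib_right)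
    also have "exp (a * of_real (ln (real n))) = of_nat n powr a"
      using elim by (simp add: powr_def Ln_of_nat)
    finally have "of_nat n powr a * J a (b + of_nat (Suc n)) * (Gamma_series b n / Gamma_series (a + b) n)
       = (pochhammer (a + b) (Suc n) * J a (b + of_nat (Suc n))) / pochhammer b (Suc n)"
      using elim by simp
    also have "pochhammer (a + b) (Suc n) * J a (b + of_nat (Suc n)) = pochhammer b (Suc n) * J a b"
      using Beta_complex_integral_pochhammer[OF a b, of "Suc n"] by (simp only: J_def)
    finally show ?case using pnz[OF b] by simp
  qed
  ultimately have "(\<lambda>n::nat. J a b) \<longlonglongrightarrow> Gamma a * (Gamma b / Gamma (a + b))"
    by (rule Lim_transform_eventually)
  then have "J a b = Beta a b"
    by (simp add: LIMSEQ_const_iff Beta_def)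
  moreover have "((\<lambda>t. of_real t powr (a - 1) * of_real (1 - t) powr (b - 1) :: complex)
      has_integral J a b) {0<..<1}"
    unfolding J_def using absolutely_integrable_Beta_complex[OF a b]
    by (intro integrable_integral) (simp add: set_lebesgue_integral_eq_integral(1))
  ultimately show ?thesis by simp
qed

section \<open>Complex powers of positive reals, and the Lavoie-Trottier integral\<close>

lemma of_real_mult_powr:
  assumes "x \<ge> 0" "y \<ge> 0"
  shows "complex_of_real (x * y) powr c = of_real x powr c * of_real y powr c"
  using assms powr_times_real[of "complex_of_real x" "complex_of_real y" c] by simp

lemma of_real_power2_powr:
  assumes "x > 0"
  shows "complex_of_real (x\<^sup>2) powr c = of_real x powr (2 * c)"
  using of_real_mult_powr[of x x c] assms by (simp only: power2_eq_square mult_2 powr_add)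

lemma of_real_powr_powr:
  assumes "x > 0"
  shows "complex_of_real (x powr r) powr c = of_real x powr (of_real r * c)"
  using assms by (simp add: powr_def Ln_of_real ac_simps)

text \<open>Holds because (2 / 3)^2 is the inverse of 9 / 4, the normalising factor of the
  substitution; this is the source of the powers of 2 / 3 in the theorem.\<close>

lemma two_thirds_powr:
  "(2 / 3 :: complex) powr (2 * c) * (9 / 4) powr c = 1"
  using of_real_mult_powr[of "(2 / 3)\<^sup>2" "9 / 4" c] of_real_power2_powr[of "2 / 3" c]
  by (simp add: power_divide)

text \<open>The weight of the theorem is the case \<open>a = lam\<close>,
  \<open>b = lam + \<rho>\<close>. Keeping a and b separate lets the Bessel terms move a while b
  stays fixed.\<close>

definition LT_kernel :: "complex \<Rightarrow> complex \<Rightarrow> real \<Rightarrow> complex" where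
  "LT_kernel a b z = of_real z powr (a - 1) * of_real (1 - z) powr (2 * b - 1)
     * of_real (1 - z / 3) powr (2 * a - 1) * of_real (1 - z / 4) powr (b - 1)"

text \<open>The factor 9 / 4 makes \<open>g 1 = 1\<close>. The derivative vanishes only at 1 and 3,
  so g increases strictly on the unit interval; the intermediate value theorem then yields the
  image.\<close>

lemma LT_substitution:
  defines "g \<equiv> \<lambda>z::real. 9 / 4 * (z * (1 - z / 3)\<^sup>2)"
  shows LT_substitution_image: "g ` {0<..<1} = {0<..<1}"
    and LT_substitution_inj: "inj_on g {0<..<1}"
    and LT_substitution_deriv: "(g has_field_derivative 9 / 4 * ((1 - z / 3) * (1 - z))) (at z within S)"
    and LT_substitution_one_minus: "1 - g z = (1 - z)\<^sup>2 * (1 - z / 4)"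
proof -
  show deriv: "(g has_field_derivative 9 / 4 * ((1 - z / 3) * (1 - z))) (at z within S)" for z S
    unfolding g_def by (auto intro!: derivative_eq_intros simp: field_simps power2_eq_square)
  show "1 - g z = (1 - z)\<^sup>2 * (1 - z / 4)"
    unfolding g_def by (simp add: field_simps power2_eq_square)
  have cont: "continuous_on A g" for A
    unfolding g_def by (intro continuous_intros) auto
  have less: "g x < g y" if "0 \<le> x" "x < y" "y \<le> 1" for x y
  proof (rule DERIV_pos_imp_increasing_open[OF that(2)])
    show "\<exists>D. DERIV g z :> D \<and> D > 0" if "x < z" "z < y" for z
      using that \<open>0 \<le> x\<close> \<open>y \<le> 1\<close> deriv[of z UNIV] by (intro exI conjI) auto
  qed (rule cont)
  have g01: "g 0 = 0" "g 1 = 1"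
    by (simp_all add: g_def power2_eq_square)
  show "inj_on g {0<..<1}"
  proof (rule linorder_inj_onI')
    show "g x \<noteq> g y" if "x \<in> {0<..<1}" "y \<in> {0<..<1}" "x < y" for x y
      using less[of x y] that by auto
  qed
  show "g ` {0<..<1} = {0<..<1}"
  proof (intro equalityI subsetI)
    fix t assume "t \<in> g ` {0<..<1}"
    then show "t \<in> {0<..<1}"
      using less[of 0] less[of _ 1] g01 by auto
  next
    fix t :: real assume t: "t \<in> {0<..<1}"
    then obtain x where x: "0 \<le> x" "x \<le> 1" "g x = t"
      using IVT'[of g 0 t 1] cont g01 by auto
    moreover have "x \<noteq> 0" "x \<noteq> 1"
      using x t g01 by auto
    ultimately show "t \<in> g ` {0<..<1}"
      by (intro image_eqI[of _ _ x]) auto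
  qed
qed

text \<open>The powers of g and of 1 - g produce the even exponents 2 (a - 1) and 2 (b - 1) on 1 - z
  / 3 and 1 - z. The derivative of g supplies one more factor of each, which gives
  \<open>2 * a - 1\<close> and \<open>2 * b - 1\<close>.\<close>

lemma Lavoie_Trottier:
  assumes a: "Re a > 0" and b: "Re b > 0"
  shows absolutely_integrable_LT_kernel: "LT_kernel a b absolutely_integrable_on {0<..<1}"
    and has_integral_LT_kernel:
      "(LT_kernel a b has_integral (2 / 3) powr (2 * a) * Beta a b) {0<..<1}"
proof -
  let ?g = "\<lambda>z::real. 9 / 4 * (z * (1 - z / 3)\<^sup>2)"
  let ?h = "\<lambda>z::real. 9 / 4 * ((1 - z / 3) * (1 - z))"
  let ?f = "\<lambda>t. of_real t powr (a - 1) * of_real (1 - t) powr (b - 1) :: complex"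
  have eq: "(2 / 3) powr (2 * a) * (\<bar>?h z\<bar> *\<^sub>R ?f (?g z)) = LT_kernel a b z"
    if z: "z \<in> {0<..<1}" for z
  proof -
    have g: "complex_of_real (?g z) powr (a - 1) =
        (9 / 4) powr (a - 1) * (of_real z powr (a - 1) * of_real (1 - z / 3) powr (2 * (a - 1)))"
      using z of_real_mult_powr[of "9 / 4" "z * (1 - z / 3)\<^sup>2" "a - 1"]
        of_real_mult_powr[of z "(1 - z / 3)\<^sup>2" "a - 1"] of_real_power2_powr[of "1 - z / 3" "a - 1"]
      by simp
    have "complex_of_real (1 - ?g z) powr (b - 1) =
        of_real (1 - z) powr (2 * (b - 1)) * of_real (1 - z / 4) powr (b - 1)"
      unfolding LT_substitution_one_minus
      using z of_real_mult_powr[of "(1 - z)\<^sup>2" "1 - z / 4" "b - 1"] of_real_power2_powr[of "1 - z" "b - 1"]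
      by simp
    moreover have "of_real (1 - z) powr (2 * b - 1)
        = complex_of_real (1 - z) powr (2 * (b - 1)) * of_real (1 - z)"
      using z powr_add[of "complex_of_real (1 - z)" "2 * (b - 1)" 1] by (simp add: algebra_simps)
    moreover have "of_real (1 - z / 3) powr (2 * a - 1)
        = complex_of_real (1 - z / 3) powr (2 * (a - 1)) * of_real (1 - z / 3)"
      using z powr_add[of "complex_of_real (1 - z / 3)" "2 * (a - 1)" 1] by (simp add: algebra_simps)
    \<comment> \<open>The constant 9 / 4 of the derivative joins (9 / 4)^(a - 1) to form (9 / 4)^a,
      which the prefactor cancels; both sides are multiplied by 4 to clear the denominator.\<close>
    moreover have "(2 / 3) powr (2 * a) * (9 * (9 / 4) powr (a - 1)) = (4 :: complex)"
    proof -
      have "9 * (9 / 4) powr (a - 1) = 4 * (9 / 4 :: complex) powr a"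
        using powr_add[of "9 / 4 :: complex" "a - 1" 1] by (simp add: mult.commute)
      then show ?thesis
        using two_thirds_powr[of a] by (simp add: mult.left_commute)
    qed
    moreover have "\<bar>?h z\<bar> = ?h z"
      using z by simp
    ultimately show ?thesis
      unfolding LT_kernel_def g by (simp add: scaleR_conv_of_real del: of_real_diff)
  qed
  have f: "?f absolutely_integrable_on ?g ` {0<..<1}" "(?f has_integral Beta a b) (?g ` {0<..<1})"
    unfolding LT_substitution_image
    by (intro absolutely_integrable_Beta_complex has_integral_Beta_complex a b)+
  note cov = absolutely_has_integral_change_of_variables[OF _ LT_substitution_deriv LT_substitution_inj f]
  have "(\<lambda>z. (2 / 3) powr (2 * a) * (\<bar>?h z\<bar> *\<^sub>R ?f (?g z))) absolutely_integrable_on {0<..<1}"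
    using cov(1) by (intro set_integrable_mult_right) auto
  then show "LT_kernel a b absolutely_integrable_on {0<..<1}"
    by (rule absolutely_integrable_spike[of _ _ "{}"]) (use eq in auto)
  have "((\<lambda>z. (2 / 3) powr (2 * a) * (\<bar>?h z\<bar> *\<^sub>R ?f (?g z))) has_integral
      (2 / 3) powr (2 * a) * Beta a b) {0<..<1}"
    using cov(2) by (intro has_integral_mult_right) auto
  then show "(LT_kernel a b has_integral (2 / 3) powr (2 * a) * Beta a b) {0<..<1}"
    by (rule has_integral_eq[rotated]) (use eq in auto)
qed

section \<open>The k-gamma function and the series of the modified k-Bessel function\<close>

text \<open>The substitution t = (k u)^(1/k) turns t^k / k into u. Its derivative is (k u)^(1/k -
  1), and together with t^(s - 1) this leaves k u to the power s/k - 1.\<close>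

lemma k_Gamma_eq_Gamma:
  assumes k: "k > 0" and s: "Re s > 0"
  shows "k_Gamma k s = of_real k powr (s / of_real k - 1) * Gamma (s / of_real k)"
proof -
  let ?g = "\<lambda>u. (k * u) powr (1 / k)"
  let ?h = "\<lambda>u. (k * u) powr (1 / k - 1)"
  let ?f = "\<lambda>t. complex_of_real t powr (s - 1) * complex_of_real (exp (- (t powr k) / k))"
  let ?w = "s / of_real k"
  have w: "Re ?w > 0" using k s by (simp add: Re_divide_of_real)
  have eq: "\<bar>?h u\<bar> *\<^sub>R ?f (?g u) =
      of_real k powr (?w - 1) * (of_real u powr (?w - 1) / of_real (exp u))"
    if u: "u \<in> {0<..}" for u
  proof -
    have ku: "k * u > 0" using k u by simp
    have "complex_of_real (?g u) powr (s - 1) = of_real (k * u) powr ((s - 1) / of_real k)"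
      using of_real_powr_powr[OF ku, of "1 / k" "s - 1"] by simp
    moreover have "complex_of_real (?h u) = of_real (k * u) powr (1 / of_real k - 1)"
      using ku powr_of_real[of "k * u" "1 / k - 1"] by simp
    ultimately have "complex_of_real (?h u) * complex_of_real (?g u) powr (s - 1)
        = of_real (k * u) powr (1 / of_real k - 1 + (s - 1) / of_real k)"
      by (simp only: powr_add)
    also have "1 / of_real k - 1 + (s - 1) / of_real k = ?w - 1"
      by (simp add: diff_divide_distrib)
    also have "complex_of_real (k * u) powr (?w - 1) = of_real k powr (?w - 1) * of_real u powr (?w - 1)"
      using k u by (intro of_real_mult_powr) auto
    finally have "complex_of_real (?h u) * complex_of_real (?g u) powr (s - 1)
        = of_real k powr (?w - 1) * of_real u powr (?w - 1)" .
    moreover have "?g u powr k = k * u"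
      using k ku by (simp add: powr_powr)
    ultimately show ?thesis
      using k by (simp add: scaleR_conv_of_real exp_minus field_simps)
  qed
  have inj: "inj_on ?g {0<..}"
    by (rule inj_on_inverseI[of _ "\<lambda>t. t powr k / k"]) (use k in \<open>simp add: powr_powr\<close>)
  have img: "?g ` {0<..} = {0<..}"
  proof (intro equalityI subsetI)
    fix t :: real assume "t \<in> {0<..}"
    then have inv: "t powr k / k \<in> {0<..}" "?g (t powr k / k) = t"
      using k by (simp_all add: powr_powr)
    show "t \<in> ?g ` {0<..}"
      by (rule image_eqI[where x = "t powr k / k"]) (simp_all only: inv)
  next
    fix t assume "t \<in> ?g ` {0<..}"
    then show "t \<in> {0<..}"
      using k by auto
  qed
  have deriv: "(?g has_field_derivative ?h u) (at u within {0<..})" if "u \<in> {0<..}" for u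
  proof -
    have "k * u > 0" using that k by simp
    then show ?thesis
      using k by (auto intro!: derivative_eq_intros)
  qed
  let ?c = "of_real k powr (?w - 1) :: complex"
  let ?G = "\<lambda>u. complex_of_real u powr (?w - 1) / of_real (exp u)"
  have "(\<lambda>u. ?c * ?G u) absolutely_integrable_on {0<..}"
    using absolutely_integrable_Gamma_integral'[OF w] by (rule set_integrable_mult_right)
  then have 1: "(\<lambda>u. \<bar>?h u\<bar> *\<^sub>R ?f (?g u)) absolutely_integrable_on {0<..}"
    by (rule absolutely_integrable_spike[of _ _ "{}"]) (use eq in auto)
  have "((\<lambda>u. ?c * ?G u) has_integral ?c * Gamma ?w) {0<..}"
    using Gamma_integral_complex'[OF w] by (rule has_integral_mult_right)
  then have "((\<lambda>u. \<bar>?h u\<bar> *\<^sub>R ?f (?g u)) has_integral ?c * Gamma ?w) {0<..}"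
    by (rule has_integral_eq[rotated]) (use eq in auto)
  then have 2: "integral {0<..} (\<lambda>u. \<bar>?h u\<bar> *\<^sub>R ?f (?g u)) = ?c * Gamma ?w"
    by (rule integral_unique)
  \<comment> \<open>The change of variables is an equivalence and is read backwards here:
    integrability and value pass from the known integral in u to the one in t.\<close>
  have "integral {0<..} ?f = ?c * Gamma ?w"
    using has_absolute_integral_change_of_variables_real[OF _ deriv inj, of ?f "?c * Gamma ?w"] 1 2 img
    by simp
  moreover have "integral {0..} ?f = integral {0<..} ?f"
    by (rule integral_spike_set; rule negligible_subset[of "{0}"]) auto
  ultimately show ?thesis
    by (simp add: k_Gamma_def)
qed

text \<open>Ratio test: by the functional equation of Gamma, consecutive terms have ratio x / ((w +
  1 + n) (n + 1)). As \<open>Re w > -1\<close>, no Gamma argument is a pole and |w + 1 + n| is at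
  least n, so the ratio is at most 1/2 once n is at least 1 and 2 |x|.\<close>

lemma summable_Bessel_coeffs:
  fixes w x :: complex
  assumes w: "Re w > -1"
  shows "summable (\<lambda>n. norm (x ^ n / (Gamma (w + 1 + of_nat n) * fact n)))"
proof -
  let ?f = "\<lambda>n. x ^ n / (Gamma (w + 1 + of_nat n) * fact n)"
  have "norm (?f (Suc n)) \<le> 1 / 2 * norm (?f n)"
    if n: "n \<ge> nat \<lceil>2 * norm x\<rceil> + 1" for n
  proof -
    have n1: "n \<ge> 1" "2 * norm x \<le> real n"
      using n by linarith+
    have nz: "w + 1 + of_nat n \<notin> \<int>\<^sub>\<le>\<^sub>0"
      using w by (auto elim!: nonpos_Ints_cases simp: complex_eq_iff)
    have "1 \<le> real n" using n1 by simp
    also have "real n \<le> Re (w + 1 + of_nat n)" using w by simp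
    also have "\<dots> \<le> norm (w + 1 + of_nat n)" by (rule complex_Re_le_cmod)
    finally have N: "1 \<le> norm (w + 1 + of_nat n)" .
    have "?f (Suc n) = ?f n * (x / ((w + 1 + of_nat n) * of_nat (Suc n)))"
      using Gamma_plus1[OF nz] by (simp add: ac_simps)
    then have eq: "norm (?f (Suc n)) = norm (?f n) * (norm x / (norm (w + 1 + of_nat n) * real (Suc n)))"
      by (simp only: norm_mult norm_divide norm_of_nat)
    have "norm x / (norm (w + 1 + of_nat n) * real (Suc n)) \<le> norm x / (1 * real n)"
      using N n1 by (intro divide_left_mono mult_mono mult_pos_pos) auto
    also have "\<dots> \<le> 1 / 2"
      using n1 by (simp add: field_simps)
    finally have "norm (?f n) * (norm x / (norm (w + 1 + of_nat n) * real (Suc n))) \<le> norm (?f n) * (1 / 2)"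
      by (rule mult_left_mono) simp
    then show ?thesis
      unfolding eq by (simp only: mult.commute)
  qed
  then show ?thesis
    by (intro summable_ratio_test[where c = "1/2" and N = "nat \<lceil>2 * norm x\<rceil> + 1"]) auto
qed

text \<open>A positive factor r splits off from any complex power, and the even integer part 2 n of
  the exponent splits off algebraically. At x = 0 the bound on \<open>Re w\<close> keeps w + 2 n
  away from 0 for n > 0, so the convention 0^0 = 1 can enter only through \<open>cpow x w\<close>,
  which stands on both sides when n = 0.\<close>

lemma cpow_scaled:
  assumes w: "Re w > -1" and r: "r > 0"
  shows "cpow (x * of_real r) (w + 2 * of_nat n)
    = cpow x w * of_real r powr w * (x\<^sup>2 * of_real (r\<^sup>2)) ^ n"
proof (cases "x = 0")
  case True
  have "w + 2 * of_nat n \<noteq> 0" if "n > 0"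
  proof -
    have "Re (w + 2 * of_nat n) > 0" using w that by simp
    then show ?thesis by (metis less_irrefl zero_complex.sel(1))
  qed
  then show ?thesis
    using True r by (cases "n = 0") (auto simp: cpow_def)
next
  case False
  have "cpow (x * of_real r) (w + 2 * of_nat n) = (of_real r * x) powr (w + of_nat (2 * n))"
    using False r by (simp add: cpow_def mult.commute)
  also have "\<dots> = (of_real r * x) powr w * (of_real r * x) ^ (2 * n)"
    using False r by (subst powr_add, subst powr_nat') auto
  also have "(of_real r * x) powr w = of_real r powr w * x powr w"
    using r by (intro powr_times_real_left) auto
  also have "(of_real r * x) ^ (2 * n) = ((of_real r * x)\<^sup>2) ^ n"
    by (rule power_mult)
  also have "(of_real r * x)\<^sup>2 = x\<^sup>2 * of_real (r\<^sup>2)"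
    by (simp add: power_mult_distrib)
  finally show ?thesis
    using False by (simp add: cpow_def)
qed

text \<open>Separates the dependence on r into \<open>r powr w\<close>, to be absorbed by the
  kernel, and a power series in r^2. Gamma_k contributes k^(w + n), of which k^w joins the prefactor
  and k^n the series variable. The 2 in the argument cancels the halving in the Bessel
  series.\<close>

lemma k_Bessel_I_scaled:
  fixes k :: real and v x :: complex
  defines "w \<equiv> v / of_real k"
  assumes k: "k > 0" and w: "Re w > -1" and r: "r > 0"
  shows "k_Bessel_I k v (2 * (x * of_real r)) = cpow x w / of_real k powr w * of_real r powr w *
     (\<Sum>n. (x\<^sup>2 / of_real k * of_real (r\<^sup>2)) ^ n / (Gamma (w + 1 + of_nat n) * fact n))"
proof -
  have "1 / (k_Gamma k (v + of_nat n * of_real k + of_real k) * fact n)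
           * cpow (2 * (x * of_real r) / 2) (v / of_real k + 2 * of_nat n)
      = cpow x w / of_real k powr w * of_real r powr w *
     ((x\<^sup>2 / of_real k * of_real (r\<^sup>2)) ^ n / (Gamma (w + 1 + of_nat n) * fact n))" for n
  proof -
    have s: "(v + of_nat n * of_real k + of_real k) / of_real k = w + 1 + of_nat n"
      using k by (simp add: w_def field_simps)
    have "Re (v + of_nat n * of_real k + of_real k) = k * (Re w + 1 + real n)"
      using k by (simp add: w_def Re_divide_of_real field_simps)
    then have "Re (v + of_nat n * of_real k + of_real k) > 0"
      using k w by simp
    then have "k_Gamma k (v + of_nat n * of_real k + of_real k)
        = of_real k powr (w + of_nat n) * Gamma (w + 1 + of_nat n)"
      using k_Gamma_eq_Gamma[OF k, of "v + of_nat n * of_real k + of_real k"]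
      unfolding s by simp
    also have "of_real k powr (w + of_nat n) = of_real k powr w * of_real k ^ n"
      using k by (subst powr_add, subst powr_nat') auto
    finally have kG: "k_Gamma k (v + of_nat n * of_real k + of_real k)
        = of_real k powr w * of_real k ^ n * Gamma (w + 1 + of_nat n)" .
    have cp: "cpow (2 * (x * of_real r) / 2) (v / of_real k + 2 * of_nat n)
        = cpow x w * of_real r powr w * (x\<^sup>2 * of_real (r\<^sup>2)) ^ n"
      using cpow_scaled[OF w r, of x n] by (simp add: w_def)
    show ?thesis
      unfolding kG cp by (simp add: power_divide power_mult_distrib)
  qed
  then show ?thesis
    unfolding k_Bessel_I_def
    using summable_norm_cancel[OF summable_Bessel_coeffs[OF w, of "x\<^sup>2 / of_real k * of_real (r\<^sup>2)"]]
    by (simp only: suminf_mult)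
qed

section \<open>Termwise integration against the kernel\<close>

lemma LT_kernel_shift:
  assumes z: "z \<in> {0<..<1}"
  shows "LT_kernel (a + c) b z = LT_kernel a b z * of_real (z * (1 - z / 3)\<^sup>2) powr c"
proof -
  have "of_real (z * (1 - z / 3)\<^sup>2) powr c = of_real z powr c * complex_of_real (1 - z / 3) powr (2 * c)"
    using z of_real_mult_powr[of z "(1 - z / 3)\<^sup>2" c] of_real_power2_powr[of "1 - z / 3" c] by simp
  moreover have "complex_of_real z powr (a + c - 1) = of_real z powr (a - 1) * of_real z powr c"
    by (simp add: add_diff_eq algebra_simps flip: powr_add)
  moreover have "complex_of_real (1 - z / 3) powr (2 * (a + c) - 1)
      = of_real (1 - z / 3) powr (2 * a - 1) * of_real (1 - z / 3) powr (2 * c)"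
    by (simp add: algebra_simps flip: powr_add)
  ultimately show ?thesis
    unfolding LT_kernel_def by (simp only: ac_simps)
qed

text \<open>The n-th term contains r^(2 n) and so shifts a by 2 n, which is the origin of the step 2
  in the Wright series. Every partial sum is dominated by the modulus of the kernel times the sum of
  all \<open>norm (c n)\<close>.\<close>

lemma LT_kernel_power_series:
  assumes a: "Re a > 0" and b: "Re b > 0" and c: "summable (\<lambda>n. norm (c n))"
  defines "r \<equiv> \<lambda>z::real. z * (1 - z / 3)\<^sup>2"
  defines "F \<equiv> \<lambda>z. LT_kernel a b z * (\<Sum>n. c n * of_real ((r z)\<^sup>2) ^ n)"
  shows "F integrable_on {0<..<1}"
    and "(\<lambda>n. c n * ((2 / 3) powr (2 * (a + of_nat (2 * n))) * Beta (a + of_nat (2 * n)) b))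
           sums integral {0<..<1} F"
proof -
  define S where "S N z = LT_kernel a b z * (\<Sum>n<N. c n * of_real ((r z)\<^sup>2) ^ n)" for N z
  define d where "d n = c n * ((2 / 3) powr (2 * (a + of_nat (2 * n))) * Beta (a + of_nat (2 * n)) b)" for n
  have r: "0 < r z" "(r z)\<^sup>2 \<le> 1" if "z \<in> {0<..<1}" for z
  proof -
    show "0 < r z" using that by (simp add: r_def)
    have "r z \<le> 1 * 1"
      unfolding r_def using that by (intro mult_mono power_le_one) auto
    with \<open>0 < r z\<close> show "(r z)\<^sup>2 \<le> 1" by (simp add: power_le_one)
  qed
  have bound: "norm (c n * of_real ((r z)\<^sup>2) ^ n) \<le> norm (c n)" if "z \<in> {0<..<1}" for z n
  proof -
    have "((r z)\<^sup>2) ^ n \<le> 1" by (rule power_le_one) (simp_all only: zero_le_power2 r[OF that])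
    then have "norm (c n) * ((r z)\<^sup>2) ^ n \<le> norm (c n) * 1"
      by (intro mult_left_mono) auto
    then show ?thesis by (simp add: norm_mult norm_power)
  qed
  have int: "(S N has_integral (\<Sum>n<N. d n)) {0<..<1}" for N
  proof (rule has_integral_eq)
    show "((\<lambda>z. \<Sum>n<N. c n * LT_kernel (a + of_nat (2 * n)) b z) has_integral (\<Sum>n<N. d n)) {0<..<1}"
      unfolding d_def using a b
      by (intro has_integral_sum has_integral_mult_right has_integral_LT_kernel) auto
    show "(\<Sum>n<N. c n * LT_kernel (a + of_nat (2 * n)) b z) = S N z" if z: "z \<in> {0<..<1}" for z
    proof -
      have "LT_kernel (a + of_nat (2 * n)) b z = LT_kernel a b z * of_real ((r z)\<^sup>2) ^ n" for n
      proof -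
        have "complex_of_real (r z) powr of_nat (2 * n) = of_real ((r z)\<^sup>2) ^ n"
          using r[OF z] by (subst powr_nat') (auto simp: power_mult)
        then show ?thesis
          using LT_kernel_shift[OF z, of a "of_nat (2 * n)" b] by (simp only: r_def)
      qed
      then show ?thesis
        by (simp add: S_def sum_distrib_left mult.left_commute)
    qed
  qed
  have dom: "(\<lambda>z. norm (LT_kernel a b z) * (\<Sum>n. norm (c n))) integrable_on {0<..<1}"
    using absolutely_integrable_LT_kernel[OF a b]
    by (intro integrable_on_mult_left) (simp add: absolutely_integrable_on_def)
  have le: "norm (S N z) \<le> norm (LT_kernel a b z) * (\<Sum>n. norm (c n))" if "z \<in> {0<..<1}" for N z
  proof -
    have "norm (\<Sum>n<N. c n * of_real ((r z)\<^sup>2) ^ n) \<le> (\<Sum>n<N. norm (c n))"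
      by (intro sum_norm_le bound that)
    also have "\<dots> \<le> (\<Sum>n. norm (c n))"
      by (intro sum_le_suminf c) auto
    finally show ?thesis
      by (simp only: S_def norm_mult mult_left_mono norm_ge_zero)
  qed
  have lim: "(\<lambda>N. S N z) \<longlonglongrightarrow> F z" if "z \<in> {0<..<1}" for z
  proof -
    have "summable (\<lambda>n. c n * of_real ((r z)\<^sup>2) ^ n)"
      using bound[OF that] by (intro summable_comparison_test[OF _ c]) auto
    then show ?thesis
      unfolding S_def F_def by (intro tendsto_intros summable_LIMSEQ)
  qed
  show "F integrable_on {0<..<1}"
    using int dom le lim by (rule dominated_convergence(1)[OF has_integral_integrable])
  have "(\<lambda>N. integral {0<..<1} (S N)) \<longlonglongrightarrow> integral {0<..<1} F"
    using int dom le lim by (rule dominated_convergence(2)[OF has_integral_integrable])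
  then show "(\<lambda>n. c n * ((2 / 3) powr (2 * (a + of_nat (2 * n))) * Beta (a + of_nat (2 * n)) b))
           sums integral {0<..<1} F"
    by (simp only: sums_def integral_unique[OF int] d_def)
qed

theorem corollary3p4:
  fixes k :: real and lam \<rho> v y :: complex
  assumes "k > 0"
    and "Re (v / of_real k) > - 1"
    and "Re (lam + \<rho>) > 0"
    and "Re (lam + v / of_real k) > 0"
  shows "((\<lambda>z::real.
             of_real z powr (lam - 1)
             * of_real (1 - z) powr (2 * (lam + \<rho>) - 1)
             * of_real (1 - z / 3) powr (2 * lam - 1)
             * of_real (1 - z / 4) powr ((lam + \<rho>) - 1)
             * k_Bessel_I k v (y * of_real (z * (1 - z / 3)\<^sup>2) / 2))
          has_integral
            cpow (y / 4) (v / of_real k) * Gamma (lam + \<rho>)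
              * (2 / 3) powr (2 * (lam + v / of_real k))
              / of_real k powr (v / of_real k)
            * Wright_1Psi2 (lam + v / of_real k) 2
                (v / of_real k + 1) 1 (2 * lam + v / of_real k + \<rho>) 2
                (y\<^sup>2 / (81 * of_real k))) {0..1}"
proof -
  define w where "w = v / of_real k"
  define a where "a = lam + w"
  define b where "b = lam + \<rho>"
  define q where "q = (y / 4)\<^sup>2 / of_real k"
  define r where "r z = z * (1 - z / 3)\<^sup>2" for z :: real
  define c where "c n = q ^ n / (Gamma (w + 1 + of_nat n) * fact n)" for n :: nat
  define F where "F z = LT_kernel a b z * (\<Sum>n. c n * of_real ((r z)\<^sup>2) ^ n)" for z
  define T where "T n = Gamma (a + of_real 2 * of_nat n)
    / (Gamma (w + 1 + of_real 1 * of_nat n) * Gamma (2 * lam + w + \<rho> + of_real 2 * of_nat n))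
    * ((y\<^sup>2 / (81 * of_real k)) ^ n / fact n)" for n :: nat
  note k = assms(1)
  have w: "Re w > -1" and a: "Re a > 0" and b: "Re b > 0"
    using assms by (simp_all add: w_def a_def b_def)
  have c: "summable (\<lambda>n. norm (c n))"
    unfolding c_def by (rule summable_Bessel_coeffs[OF w])
  note series = LT_kernel_power_series[OF a b c, folded r_def, folded F_def]
  let ?P = "(2 / 3) powr (2 * a) * Gamma b"
  \<comment> \<open>The Beta value contributes both Gamma factors with step 2; its remaining factor
    \<open>Gamma b\<close> is free of n and moves to the prefactor.\<close>
  have "c n * ((2 / 3) powr (2 * (a + of_nat (2 * n))) * Beta (a + of_nat (2 * n)) b) = ?P * T n" for n
  proof -
    have "(2 / 3 :: complex) powr (2 * (a + of_nat (2 * n))) = (2 / 3) powr (2 * a + of_nat (4 * n))"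
      by (simp add: algebra_simps)
    also have "\<dots> = (2 / 3) powr (2 * a) * (16 / 81) ^ n"
      by (subst powr_add, subst powr_nat') (auto simp: power_mult power_divide)
    finally have A: "(2 / 3 :: complex) powr (2 * (a + of_nat (2 * n))) = (2 / 3) powr (2 * a) * (16 / 81) ^ n" .
    have "q * (16 / 81) = y\<^sup>2 / (81 * of_real k)"
      by (simp add: q_def power_divide)
    then have Q: "q ^ n * (16 / 81) ^ n = (y\<^sup>2 / (81 * of_real k)) ^ n"
      by (simp only: power_mult_distrib[symmetric])
    have G: "a + of_nat (2 * n) + b = 2 * lam + w + \<rho> + of_real 2 * of_nat n"
      by (simp add: a_def b_def)
    show ?thesis
      unfolding T_def c_def Beta_def A G Q[symmetric] by (simp add: ac_simps)
  qed
  with series(2) have "(\<lambda>n. ?P * T n) sums integral {0<..<1} F"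
    by simp
  \<comment> \<open>Dividing by \<open>?P\<close> passes from convergence of the scaled series to
    convergence of \<open>T\<close> itself, so that \<open>suminf T\<close> is a genuine
    sum.\<close>
  moreover have P: "?P \<noteq> 0"
    using b by (auto simp: Gamma_eq_zero_iff elim!: nonpos_Ints_cases)
  ultimately have "T sums (integral {0<..<1} F / ?P)"
    using sums_mult_D by fastforce
  then have "suminf T = integral {0<..<1} F / ?P"
    by (rule sums_unique[symmetric])
  then have F: "(F has_integral ?P * suminf T) {0<..<1}"
    using series(1) P by (simp add: has_integral_iff)
  let ?C = "cpow (y / 4) w / of_real k powr w"
  have "((\<lambda>z. ?C * F z) has_integral ?C * (?P * suminf T)) {0<..<1}"
    using F by (rule has_integral_mult_right)
  then have "((\<lambda>z::real.
             of_real z powr (lam - 1)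
             * of_real (1 - z) powr (2 * (lam + \<rho>) - 1)
             * of_real (1 - z / 3) powr (2 * lam - 1)
             * of_real (1 - z / 4) powr ((lam + \<rho>) - 1)
             * k_Bessel_I k v (y * of_real (z * (1 - z / 3)\<^sup>2) / 2)) has_integral ?C * (?P * suminf T)) {0<..<1}"
  proof (rule has_integral_eq[rotated])
    fix z :: real assume z: "z \<in> {0<..<1}"
    then have "r z > 0" by (simp add: r_def)
    have y: "2 * (y / 4 * of_real (r z)) = y * of_real (r z) / 2"
      by simp
    have cn: "c n * of_real ((r z)\<^sup>2) ^ n =
        (q * of_real ((r z)\<^sup>2)) ^ n / (Gamma (w + 1 + of_nat n) * fact n)" for n
      by (simp add: c_def power_mult_distrib)
    have bessel: "k_Bessel_I k v (y * of_real (r z) / 2) = ?C * of_real (r z) powr w *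
        (\<Sum>n. c n * of_real ((r z)\<^sup>2) ^ n)"
      using k_Bessel_I_scaled[OF k w[unfolded w_def] \<open>r z > 0\<close>, of "y / 4", folded w_def q_def]
      unfolding y cn .
    \<comment> \<open>Undoes the absorption: the kernel with first parameter \<open>lam + w\<close>
      is the original weight times \<open>r powr w\<close>, and this power completes the Bessel
      function.\<close>
    have "?C * F z = LT_kernel lam b z * (?C * of_real (r z) powr w * (\<Sum>n. c n * of_real ((r z)\<^sup>2) ^ n))"
      unfolding F_def a_def r_def LT_kernel_shift[OF z] by (simp only: ac_simps)
    also have "\<dots> = LT_kernel lam b z * k_Bessel_I k v (y * of_real (r z) / 2)"
      unfolding bessel ..
    finally show "?C * F z = of_real z powr (lam - 1)
             * of_real (1 - z) powr (2 * (lam + \<rho>) - 1)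
             * of_real (1 - z / 3) powr (2 * lam - 1)
             * of_real (1 - z / 4) powr ((lam + \<rho>) - 1)
             * k_Bessel_I k v (y * of_real (z * (1 - z / 3)\<^sup>2) / 2)"
      unfolding LT_kernel_def r_def b_def .
  qed
  moreover have "suminf T = Wright_1Psi2 a 2 (w + 1) 1 (2 * lam + w + \<rho>) 2 (y\<^sup>2 / (81 * of_real k))"
    unfolding Wright_1Psi2_def T_def ..
  ultimately show ?thesis
    unfolding has_integral_Icc_iff_Ioo w_def[symmetric] a_def[symmetric] b_def[symmetric]
    by (simp add: mult_ac)
qed

end
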